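(* For $n\geq 3$, values of the circumcircle radius function $J\colon\mathcal{AC}_n\to(0,\infty)$ approach infinity on any sequence in $\mathcal{AC}_n$ approaching $\mathcal{HC}_n$ or $\mathcal{HI}_n$; that is, if a sequence $\mathbf{d}^{(k)}\in\mathcal{AC}_n$ converges in $(0,\infty]^n$ to a point of $\mathcal{HC}_n\cup\mathcal{HI}_n$, then $J(\mathbf{d}^{(k)})\to\infty$.
   Context: Define $$\mathcal{AC}_n=\Big\{(d_0,\ldots,d_{n-1})\in(0,\infty)^n : \sinh(d_i/2)<\sum_{j\neq i}\sinh(d_j/2)\text{ for each } i\Big\},$$ $$\mathcal{HC}_n=\Big\{(d_0,\ldots,d_{n-1})\in(0,\infty)^n : \sinh(d_{i_0}/2)=\sum_{i\neq i_0}\sinh(d_i/2),\text{ where } d_{i_0}=\max_i d_i\Big\},$$ and let $\mathcal{HI}_n$ be the set of $(d_0,\ldots,d_{n-1})\in(0,\infty]^n$ such that, for some $i_0$, $d_{i_0}=d_{i_0+1}=\infty$ (indices mod $n$) and all other entries are finite. A cyclic $n$-gon in the hyperbolic plane $\mathbb{H}^2$ with side length collection $(d_0,\ldots,d_{n-1})$ is a set $\{x_0,\ldots,x_{n-1}\}$ of points on a hyperbolic metric circle (its circumcircle), cyclically ordered counterclockwise (for each $i$ with $1\le i\le n-1$, the counterclockwise half-open arc $(x_{i-1},x_i]$ contains no $x_j$ with $j\neq i$), such that $\mathrm{dist}(x_{i-1},x_i)=d_i$ for $i>0$ and $\mathrm{dist}(x_{n-1},x_0)=d_0$. The set $\mathcal{AC}_n$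 is exactly the set of side length collections of cyclic $n$-gons, and a cyclic $n$-gon is determined up to isometry by its side length collection; $J(\mathbf{d})$ is the circumcircle radius of a cyclic $n$-gon with side length collection $\mathbf{d}$. *)

theory Defs
  imports "HOL-Analysis.Analysis"
begin

text \<open>An n-tuple indexed by 0, ..., n-1 is an extensional function on \<^term>\<open>{..<n}\<close>.\<close>

definition AC :: "nat \<Rightarrow> (nat \<Rightarrow> real) set" where
  "AC n = {d \<in> {..<n} \<rightarrow>\<^sub>E {0<..}.
     \<forall>i<n. sinh (d i / 2) < (\<Sum>j\<in>{..<n} - {i}. sinh (d j / 2))}"

definition HC :: "nat \<Rightarrow> (nat \<Rightarrow> real) set" where
  "HC n = {d \<in> {..<n} \<rightarrow>\<^sub>E {0<..}.
     \<exists>i0<n. d i0 = Max (d ` {..<n}) \<and>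
       sinh (d i0 / 2) = (\<Sum>i\<in>{..<n} - {i0}. sinh (d i / 2))}"

definition HI :: "nat \<Rightarrow> (nat \<Rightarrow> ereal) set" where
  "HI n = {d \<in> {..<n} \<rightarrow>\<^sub>E {0<..}.
     \<exists>i0<n. d i0 = \<infinity> \<and> d ((i0 + 1) mod n) = \<infinity> \<and>
       (\<forall>i<n. i \<noteq> i0 \<and> i \<noteq> (i0 + 1) mod n \<longrightarrow> d i \<noteq> \<infinity>)}"

text \<open>The space \<open>(0,\<infinity>]\<^sup>n\<close> and the inclusion of \<open>(0,\<infinity>)\<^sup>n\<close> into it.\<close>

definition ext_tuples :: "nat \<Rightarrow> (nat \<Rightarrow> ereal) topology" where
  "ext_tuples n = product_topology (\<lambda>_. top_of_set {0<..}) {..<n}"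

definition ereal_tuple :: "nat \<Rightarrow> (nat \<Rightarrow> real) \<Rightarrow> (nat \<Rightarrow> ereal)" where
  "ereal_tuple n d = (\<lambda>i\<in>{..<n}. ereal (d i))"

text \<open>The hyperbolic plane (curvature -1) in the Poincare disc model.\<close>

definition hplane :: "complex set" where
  "hplane = ball 0 1"

definition hdist :: "complex \<Rightarrow> complex \<Rightarrow> real" where
  "hdist z w = arcosh (1 + 2 * (cmod (z - w))\<^sup>2 / ((1 - (cmod z)\<^sup>2) * (1 - (cmod w)\<^sup>2)))"

definition hcircle :: "complex \<Rightarrow> real \<Rightarrow> complex set" where
  "hcircle c r = {z \<in> hplane. hdist c z = r}"

text \<open>
  Counterclockwise parametrization of \<^term>\<open>hcircle c r\<close>: the circle of hyperbolic radius \<open>r\<close>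
  about the origin is the Euclidean circle of radius \<open>tanh (r / 2)\<close>, and
  \<open>w \<mapsto> (w + c) / (1 + cnj c * w)\<close> is an orientation-preserving isometry of the disc taking
  the origin to \<open>c\<close>.
\<close>

definition hcircle_point :: "complex \<Rightarrow> real \<Rightarrow> real \<Rightarrow> complex" where
  "hcircle_point c r t =
     (let w = of_real (tanh (r / 2)) * cis t in (w + c) / (1 + cnj c * w))"

text \<open>The counterclockwise half-open arc \<open>(p, q]\<close>; for \<open>p = q\<close> it is the whole circle.\<close>

definition ccw_arc :: "complex \<Rightarrow> real \<Rightarrow> complex \<Rightarrow> complex \<Rightarrow> complex set" where
  "ccw_arc c r p q = {hcircle_point c r t | t a b.
     p = hcircle_point c r a \<and> q = hcircle_point c r b \<and>
     a < b \<and> b \<le> a + 2 * pi \<and> a < t \<and> t \<le> b}"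

text \<open>
  The points \<open>x 0, ..., x (n-1)\<close> form a cyclic n-gon with side length collection \<open>d\<close> whose
  circumcircle has centre \<open>c\<close> and radius \<open>r\<close>.
\<close>

definition cyclic_ngon ::
  "nat \<Rightarrow> (nat \<Rightarrow> real) \<Rightarrow> (nat \<Rightarrow> complex) \<Rightarrow> complex \<Rightarrow> real \<Rightarrow> bool" where
  "cyclic_ngon n d x c r \<longleftrightarrow>
     c \<in> hplane \<and> 0 < r \<and> x ` {..<n} \<subseteq> hcircle c r \<and>
     (\<forall>i\<in>{1..<n}. \<forall>j<n. j \<noteq> i \<longrightarrow> x j \<notin> ccw_arc c r (x (i - 1)) (x i)) \<and>
     (\<forall>i\<in>{1..<n}. hdist (x (i - 1)) (x i) = d i) \<and>
     hdist (x (n - 1)) (x 0) = d 0"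

definition J :: "nat \<Rightarrow> (nat \<Rightarrow> real) \<Rightarrow> real" where
  "J n d = (THE r. \<exists>x c. cyclic_ngon n d x c r)"

end

(* Writing s_i = sinh (d_i/2), a cyclic n-gon of circumradius r amounts to angles alpha_i in (0, pi)
   (half the central angles) with sum pi and s_i = R sin alpha_i, where R = sinh r: the problem is
   that of a Euclidean inscribed polygon with sides 2 s_i. Comparing the angles for two radii at
   all vertices except that of a longest side shows that R is unique, and the intermediate value
   theorem gives existence, so R = sinh (J d). A side length tending to infinity forces R to
   infinity because s_i <= R. Near a point of HC, with longest side m, the gap
   sum_{i ~= m} s_i - s_m tends to 0, while it is at least s_a s_b^2 / (2 R^2) for any two
   other sides a, b. *)

theory Submission imports Defs
begin

subsection \<open>Inscribed polygons\<close>

text \<open>\<open>\<alpha> i\<close> is half the central angle over a Euclidean chord of length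
  \<open>2 * s i\<close>; an angle above pi/2 puts the centre beyond that side. The sign of
  \<open>R\<close> is left open and follows from \<open>0 < s i\<close>.\<close>

definition inscribed :: "'a set \<Rightarrow> ('a \<Rightarrow> real) \<Rightarrow> real \<Rightarrow> ('a \<Rightarrow> real) \<Rightarrow> bool" where
  "inscribed I s R \<alpha> \<longleftrightarrow>
     (\<forall>i\<in>I. 0 < \<alpha> i \<and> \<alpha> i < pi \<and> s i = R * sin (\<alpha> i)) \<and> sum \<alpha> I = pi"

section \<open>Sines of sums of angles\<close>

lemma sin_sum_le_sum_sin:
  assumes "finite A" "\<And>i. i \<in> A \<Longrightarrow> 0 \<le> (\<alpha> i :: real)" "sum \<alpha> A \<le> pi"
  shows "sin (sum \<alpha> A) \<le> (\<Sum>i\<in>A. sin (\<alpha> i))"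
  using assms
proof (induction A rule: finite_induct)
  case (insert a A)
  have nonneg: "0 \<le> sum \<alpha> A" "0 \<le> \<alpha> a"
    using insert.prems by (auto intro: sum_nonneg)
  then have le: "sum \<alpha> A \<le> pi" "\<alpha> a \<le> pi"
    using insert.prems(2) insert.hyps by auto
  have "sin (\<alpha> a + sum \<alpha> A) = sin (\<alpha> a) * cos (sum \<alpha> A) + cos (\<alpha> a) * sin (sum \<alpha> A)"
    by (rule sin_add)
  also have "\<dots> \<le> sin (\<alpha> a) * 1 + 1 * sin (sum \<alpha> A)"
    using nonneg le by (intro add_mono mult_left_mono mult_right_mono sin_ge_zero cos_le_one)
  finally show ?case
    using insert le by auto
qed simp

text \<open>Induction with the addition formula: cosine decreases on [0, pi], so passing from
  \<open>x\<close> to \<open>y\<close> lowers no cosine, and \<open>cos (x a)\<close> is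
  nonnegative, so the induction hypothesis can be multiplied by it. In the application
  \<open>x\<close> and \<open>y\<close> are angles in two circles and \<open>l\<close> is the ratio
  of the radii.\<close>

lemma sin_sum_scaled_le:
  fixes x y :: "'a \<Rightarrow> real"
  assumes "finite A" "0 \<le> l" "sum x A \<le> pi"
    and "\<And>i. i \<in> A \<Longrightarrow> 0 \<le> y i \<and> y i \<le> x i \<and> x i \<le> pi / 2 \<and> sin (x i) = l * sin (y i)"
  shows "sin (sum x A) \<le> l * sin (sum y A)"
  using assms
proof (induction A rule: finite_induct)
  case (insert a A)
  have nonneg: "0 \<le> sum y A" "0 \<le> y a" "y a \<le> x a" "sum y A \<le> sum x A"
      and a: "x a \<le> pi / 2" "sin (x a) = l * sin (y a)"
    using insert.prems by (auto intro!: sum_nonneg sum_mono)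
  then have le: "sum x A \<le> pi" "x a \<le> pi"
    using insert.prems(2) insert.hyps by auto
  have IH: "sin (sum x A) \<le> l * sin (sum y A)"
    using insert le by auto
  have "sin (x a + sum x A) = l * sin (y a) * cos (sum x A) + cos (x a) * sin (sum x A)"
    by (simp add: sin_add a)
  also have "\<dots> \<le> l * sin (y a) * cos (sum y A) + cos (x a) * (l * sin (sum y A))"
    using nonneg le a \<open>0 \<le> l\<close> IH
    by (intro add_mono mult_left_mono mult_nonneg_nonneg sin_ge_zero cos_monotone_0_pi_le cos_ge_zero) auto
  also have "\<dots> \<le> l * sin (y a) * cos (sum y A) + cos (y a) * (l * sin (sum y A))"
    using nonneg le a \<open>0 \<le> l\<close>
    by (intro add_mono order_refl mult_right_mono mult_nonneg_nonneg sin_ge_zero cos_monotone_0_pi_le) auto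
  also have "\<dots> = l * sin (y a + sum y A)"
    by (simp add: sin_add algebra_simps)
  finally show ?case
    using insert.hyps by simp
qed simp

text \<open>Strictness comes from \<open>cos (sum x B) < cos (sum y B)\<close> for the indices
  \<open>B\<close> that remain after splitting off \<open>a\<close>; \<open>B\<close> is nonempty as
  there are at least two indices. A single index would give equality.\<close>

lemma sin_sum_scaled_less:
  fixes x y :: "'a \<Rightarrow> real"
  assumes "finite A" "2 \<le> card A" "0 < l" "sum x A \<le> pi"
    and "\<And>i. i \<in> A \<Longrightarrow> 0 < y i \<and> y i < x i \<and> x i \<le> pi / 2 \<and> sin (x i) = l * sin (y i)"
  shows "sin (sum x A) < l * sin (sum y A)"
proof -
  obtain a where a: "a \<in> A" using assms(2) by fastforce
  define B where "B = A - {a}"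
  have B: "finite B" "B \<noteq> {}" "A = insert a B" "a \<notin> B"
    using a assms(1,2) unfolding B_def by (auto dest: card_mono[rotated, of A "{a}"])
  have pos: "0 < sum y B" "0 < y a" "y a < x a" "sum y B < sum x B"
      and xa: "x a \<le> pi / 2" "sin (x a) = l * sin (y a)"
    using assms(5) B by (auto intro!: sum_pos sum_strict_mono)
  have le: "sum x B \<le> pi" "x a \<le> pi"
    using assms(4) B pos by auto
  have B_le: "sin (sum x B) \<le> l * sin (sum y B)"
    using assms B le by (intro sin_sum_scaled_le) (auto simp: less_imp_le)
  have "sin (x a + sum x B) = l * sin (y a) * cos (sum x B) + cos (x a) * sin (sum x B)"
    by (simp add: sin_add xa)
  also have "\<dots> < l * sin (y a) * cos (sum y B) + cos (x a) * (l * sin (sum y B))"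
    using pos le xa \<open>0 < l\<close> B_le
    by (intro add_less_le_mono mult_strict_left_mono mult_left_mono mult_pos_pos sin_gt_zero
        cos_monotone_0_pi cos_ge_zero) auto
  also have "\<dots> \<le> l * sin (y a) * cos (sum y B) + cos (y a) * (l * sin (sum y B))"
    using pos le xa \<open>0 < l\<close>
    by (intro add_mono order_refl mult_right_mono mult_nonneg_nonneg sin_ge_zero
        cos_monotone_0_pi_le) auto
  also have "\<dots> = l * sin (y a + sum y B)"
    by (simp add: sin_add algebra_simps)
  finally show ?thesis
    using B by simp
qed

section \<open>Radius of an inscribed polygon: bounds, uniqueness, existence\<close>

lemma inscribed_radius_ge:
  assumes "inscribed I s R \<alpha>" "i \<in> I" "0 < s i"
  shows "0 < R" "s i \<le> R"
proof -
  have *: "0 < sin (\<alpha> i)" "s i = R * sin (\<alpha> i)"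
    using assms by (auto simp: inscribed_def sin_gt_zero)
  then show "0 < R"
    using assms(3) by (simp add: zero_less_mult_iff)
  then show "s i \<le> R"
    using * by (simp add: mult_left_le)
qed

text \<open>An obtuse \<open>\<alpha> i\<close> and the positive angle of a third side would force
  \<open>\<alpha> m < pi - \<alpha> i < pi / 2\<close>, hence a smaller sine at \<open>m\<close>,
  against \<open>s i \<le> s m\<close>.\<close>

lemma inscribed_acute:
  assumes "finite I" "3 \<le> card I" "inscribed I s R \<alpha>" "0 < R"
    and "m \<in> I" "i \<in> I" "i \<noteq> m" "s i \<le> s m"
  shows "\<alpha> i \<le> pi / 2"
proof (rule ccontr)
  assume "\<not> \<alpha> i \<le> pi / 2"
  have "\<not> I \<subseteq> {i, m}"
    using assms(2,7) card_mono[of "{i, m}" I] by auto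
  then obtain j where "j \<in> I - {i, m}" by auto
  then have "sum \<alpha> {i, m} < sum \<alpha> I"
    using assms by (intro sum_strict_mono2) (auto simp: inscribed_def less_imp_le)
  then have "\<alpha> i + \<alpha> m < pi"
    using assms by (simp add: inscribed_def)
  then have "sin (\<alpha> m) < sin (pi - \<alpha> i)"
    using \<open>\<not> \<alpha> i \<le> pi / 2\<close> assms by (intro sin_monotone_2pi) (auto simp: inscribed_def)
  then have "s m < s i"
    using assms by (simp add: inscribed_def)
  then show False using assms by simp
qed

text \<open>Angle \<open>m\<close> is the supplement of the sum of the others. For a longest side
  \<open>m\<close> this trades the one possibly obtuse angle for angles that can be compared between
  circles.\<close>

lemma inscribed_sin_sum_others:
  assumes "finite I" "inscribed I s R \<alpha>" "m \<in> I"
  shows "sum \<alpha> (I - {m}) \<le> pi" "s m = R * sin (sum \<alpha> (I - {m}))"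
proof -
  have "sum \<alpha> (I - {m}) = pi - \<alpha> m"
    using assms by (simp add: inscribed_def sum_diff1)
  then show "sum \<alpha> (I - {m}) \<le> pi" "s m = R * sin (sum \<alpha> (I - {m}))"
    using assms by (auto simp: inscribed_def)
qed

text \<open>If \<open>R < S\<close>, all angles away from a longest side \<open>m\<close> are at
  most pi/2, hence strictly larger in the circle of radius \<open>R\<close>;
  \<open>sin_sum_scaled_less\<close> then separates two expressions that both equal
  \<open>s m\<close>. Applied in both directions, this gives uniqueness of the radius.\<close>

lemma inscribed_radius_le:
  assumes "finite I" "3 \<le> card I" and pos: "\<And>i. i \<in> I \<Longrightarrow> 0 < s i"
    and R: "inscribed I s R \<alpha>" and S: "inscribed I s S \<beta>"
  shows "S \<le> R"
proof (rule ccontr)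
  assume "\<not> S \<le> R"
  then have RS: "R < S" by simp
  have "Max (s ` I) \<in> s ` I" using assms(1,2) by (intro Max_in) auto
  then obtain m where m: "m \<in> I" "\<And>i. i \<in> I \<Longrightarrow> s i \<le> s m"
    using assms(1) by (metis (no_types, lifting) Max_ge finite_imageI imageE imageI)
  have "0 < R" "0 < S"
    using inscribed_radius_ge[OF R] inscribed_radius_ge[OF S] m(1) pos by auto
  \<comment> \<open>The factor \<open>S / R\<close> is the ratio of the sines, from
    \<open>R * sin (\<alpha> i) = S * sin (\<beta> i)\<close>.\<close>
  have "sin (sum \<alpha> (I - {m})) < S / R * sin (sum \<beta> (I - {m}))"
  proof (rule sin_sum_scaled_less)
    show "2 \<le> card (I - {m})" using assms(1,2) m(1) by simp
    show "sum \<alpha> (I - {m}) \<le> pi"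
      using inscribed_sin_sum_others[OF assms(1) R m(1)] by simp
    fix i assume i: "i \<in> I - {m}"
    have acute: "\<alpha> i \<le> pi / 2" "\<beta> i \<le> pi / 2"
      using inscribed_acute[OF assms(1,2) R \<open>0 < R\<close> m(1)]
        inscribed_acute[OF assms(1,2) S \<open>0 < S\<close> m(1)] i m(2) by auto
    have *: "0 < \<alpha> i" "0 < \<beta> i" "R * sin (\<alpha> i) = S * sin (\<beta> i)"
      using i R S by (auto simp: inscribed_def)
    have "0 < sin (\<beta> i)"
      using acute * by (intro sin_gt_zero) auto
    then have "R * sin (\<beta> i) < R * sin (\<alpha> i)"
      using RS * by simp
    then have "sin (\<beta> i) < sin (\<alpha> i)"
      using \<open>0 < R\<close> by simp
    then have "\<beta> i < \<alpha> i"
      using acute * by (subst (asm) sin_mono_less_eq) auto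
    then show "0 < \<beta> i \<and> \<beta> i < \<alpha> i \<and> \<alpha> i \<le> pi / 2 \<and> sin (\<alpha> i) = S / R * sin (\<beta> i)"
      using acute * \<open>0 < R\<close> by (simp add: field_simps)
  qed (use assms(1) \<open>0 < R\<close> \<open>0 < S\<close> in auto)
  then have "R * sin (sum \<alpha> (I - {m})) < S * sin (sum \<beta> (I - {m}))"
    using \<open>0 < R\<close> by (simp add: field_simps)
  then show False
    using inscribed_sin_sum_others[OF assms(1) R m(1)]
      inscribed_sin_sum_others[OF assms(1) S m(1)] by simp
qed

text \<open>Intermediate value theorem in the unknown \<open>u = 1 / R\<close>: the sides other than
  a longest one \<open>m\<close> take the angles \<open>arcsin (s i * u)\<close>, and
  \<open>u\<close> is varied until side \<open>m\<close> closes the polygon.\<close>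

lemma inscribed_exists:
  assumes "finite I" "I \<noteq> {}" and pos: "\<And>i. i \<in> I \<Longrightarrow> 0 < s i"
    and less: "\<And>i. i \<in> I \<Longrightarrow> s i < sum s (I - {i})"
  shows "\<exists>R \<alpha>. inscribed I s R \<alpha>"
proof -
  have "Max (s ` I) \<in> s ` I" using assms(1,2) by simp
  then obtain m where m: "m \<in> I" "\<And>i. i \<in> I \<Longrightarrow> s i \<le> s m"
    using assms(1) by (metis (no_types, lifting) Max_ge finite_imageI imageE imageI)
  have sm: "0 < s m" using pos m by simp
  define A where "A = I - {m}"
  \<comment> \<open>\<open>X u\<close> is the total angle of the sides other than \<open>m\<close>;
    \<open>H u = 0\<close> says that side \<open>m\<close> fits the remaining angle
    \<open>pi - X u\<close>.\<close>
  define X where "X u = (\<Sum>i\<in>A. arcsin (s i * u))" for u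
  define H where "H u = sin (X u) - s m * u" for u
  have "finite A" using assms(1) by (simp add: A_def)
  \<comment> \<open>Since \<open>s i \<le> s m\<close>, the arguments of arcsin stay in its domain
    up to \<open>u = 1 / s m\<close>.\<close>
  have range: "0 \<le> s i * u \<and> s i * u \<le> 1" if "i \<in> A" "0 \<le> u" "u \<le> 1 / s m" for i u
  proof -
    have "s i * u \<le> s m * (1 / s m)"
      using that m pos sm by (intro mult_mono) (auto simp: A_def less_imp_le)
    then show ?thesis using that pos sm by (auto simp: A_def less_imp_le)
  qed
  have contX: "continuous_on {0..1 / s m} X"
    unfolding X_def using range
    by (intro continuous_intros ballI conjI) (fastforce intro: order_trans[of "-1" 0])+
  have X0: "X 0 = 0" by (simp add: X_def)
  have X_nonneg: "0 \<le> X u" if "0 \<le> u" "u \<le> 1 / s m" for u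
    unfolding X_def using range[OF _ that] by (intro sum_nonneg) (auto intro: arcsin_nonneg)
  have mono: "X u \<le> X v" if "0 \<le> u" "u \<le> v" "v \<le> 1 / s m" for u v
    unfolding X_def
  proof (intro sum_mono arcsin_le_arcsin)
    fix i assume i: "i \<in> A"
    then show "s i * u \<le> s i * v"
      using that pos by (auto simp: A_def less_imp_le intro!: mult_left_mono)
    show "s i * v \<le> 1" "- 1 \<le> s i * u"
      using range[OF i, of u] range[OF i, of v] that by auto
  qed
  \<comment> \<open>At \<open>1 / s m\<close> the value of \<open>H\<close> is a sine minus 1. If
    the total angle exceeds pi there, \<open>v\<close> is a point where it equals pi and the sine
    vanishes.\<close>
  obtain v where v: "0 < v" "v \<le> 1 / s m" "X v \<le> pi" "H v \<le> 0"
  proof (cases "X (1 / s m) \<le> pi")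
    case True
    then show ?thesis
      using sm that[of "1 / s m"] by (simp add: H_def)
  next
    case False
    then obtain v where v: "0 \<le> v" "v \<le> 1 / s m" "X v = pi"
      using IVT'[of X 0 pi "1 / s m"] contX X0 sm by auto
    then have "v \<noteq> 0" using X0 by auto
    then show ?thesis using v sm that[of v] by (simp add: H_def)
  qed
  \<comment> \<open>Sine and arcsin have derivative 1 at 0, so the strict polygon inequality at
    \<open>m\<close> makes \<open>H\<close> positive just to the right of 0.\<close>
  have "(H has_real_derivative (sum s A - s m)) (at 0)"
    unfolding H_def X_def by (auto intro!: derivative_eq_intros)
  moreover have "0 < sum s A - s m"
    using less[OF m(1)] by (simp add: A_def)
  ultimately obtain e where e: "0 < e" "\<And>h. 0 < h \<Longrightarrow> h < e \<Longrightarrow> H 0 < H h"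
    using DERIV_pos_inc_right[of H "sum s A - s m" 0] by auto
  \<comment> \<open>\<open>H 0 = 0\<close> is a spurious zero; starting at a positive
    \<open>w\<close> below both \<open>v\<close> and \<open>e\<close> avoids it.\<close>
  define w where "w = min (v / 2) (e / 2)"
  have w: "0 < w" "w < v" "0 < H w"
    using e(1) e(2)[of w] v by (auto simp: w_def H_def X0)
  have "continuous_on {w..v} H"
    unfolding H_def using v w
    by (intro continuous_intros continuous_on_subset[OF contX]) auto
  then obtain u where u: "w \<le> u" "u \<le> v" "H u = 0"
    using IVT2'[of H v 0 w] w v by auto
  then have u': "0 < u" "u \<le> 1 / s m" using v w by auto
  have sinX: "sin (X u) = s m * u" using u by (simp add: H_def)
  \<comment> \<open>Positivity of \<open>sin (X u)\<close> excludes the ends 0 and pi, so the angle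
    at \<open>m\<close> lies strictly between them.\<close>
  have "X u \<le> pi" using mono[of u v] u u' v by simp
  moreover have "0 < sin (X u)" using sinX sm u' by simp
  ultimately have X: "0 < X u" "X u < pi"
    using X_nonneg[of u] u' by (auto simp: less_le)
  define \<alpha> where "\<alpha> i = (if i = m then pi - X u else arcsin (s i * u))" for i
  have "inscribed I s (1 / u) \<alpha>"
    unfolding inscribed_def
  proof (intro conjI[of "\<forall>i\<in>I. _ i"] ballI)
    have "sum \<alpha> I = \<alpha> m + sum \<alpha> A"
      unfolding A_def using assms(1) m(1) by (simp add: sum.remove)
    also have "sum \<alpha> A = X u"
      unfolding X_def by (intro sum.cong) (auto simp: \<alpha>_def A_def)
    finally show "sum \<alpha> I = pi" by (simp add: \<alpha>_def)
    fix i assume i: "i \<in> I"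
    show "0 < \<alpha> i \<and> \<alpha> i < pi \<and> s i = 1 / u * sin (\<alpha> i)"
    proof (cases "i = m")
      case True
      then show ?thesis using X sinX u' by (simp add: \<alpha>_def)
    next
      case False
      then have r: "0 < s i * u" "s i * u \<le> 1"
        using range[of i u] i u' pos by (auto simp: A_def)
      have "0 < arcsin (s i * u)" "arcsin (s i * u) < pi"
        using arcsin_less_arcsin[of 0 "s i * u"] arcsin_bounded[of "s i * u"] r pi_gt_zero by auto
      then show ?thesis using False r u' by (simp add: \<alpha>_def)
    qed
  qed
  then show ?thesis by blast
qed

text \<open>Subadditivity of sine, with \<open>\<alpha> a + \<alpha> b\<close> kept as one angle,
  bounds the gap below by that of a triangle, \<open>R * (sin (\<alpha> a) + sin (\<alpha> b) - sin
  (\<alpha> a + \<alpha> b))\<close>. This is at least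
  \<open>R * sin (\<alpha> a) * (1 - cos (\<alpha> b))\<close>, and \<open>1 - cos x\<close> is at
  least \<open>(sin x)^2 / 2\<close>.\<close>

lemma inscribed_gap:
  assumes "finite I" "inscribed I s R \<alpha>" "0 < R"
    and "m \<in> I" "a \<in> I" "b \<in> I" "a \<noteq> b" "a \<noteq> m" "b \<noteq> m"
  shows "s a * (s b)\<^sup>2 \<le> 2 * R\<^sup>2 * (sum s (I - {m}) - s m)"
proof -
  define B where "B = I - {m, a, b}"
  have \<alpha>: "\<And>i. i \<in> I \<Longrightarrow> 0 < \<alpha> i \<and> \<alpha> i < pi \<and> s i = R * sin (\<alpha> i)"
    using assms by (auto simp: inscribed_def)
  have split: "sum f (I - {m}) = f a + f b + sum f B" for f :: "_ \<Rightarrow> real"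
  proof -
    have "I - {m} = insert a (insert b B)" "a \<notin> insert b B" "b \<notin> B" "finite B"
      using assms by (auto simp: B_def)
    then show ?thesis by (simp add: add.assoc)
  qed
  note others = inscribed_sin_sum_others[OF assms(1,2,4)]
  have B0: "0 \<le> sum \<alpha> B" using \<alpha> by (intro sum_nonneg) (auto simp: B_def less_imp_le)
  \<comment> \<open>A family with two members, so that the lemma on finite sums yields subadditivity
    for the two groups of angles.\<close>
  let ?t = "\<lambda>i::nat. if i = 0 then \<alpha> a + \<alpha> b else sum \<alpha> B"
  have "sin (sum ?t {..<2}) \<le> (\<Sum>i<2. sin (?t i))"
    using others(1) \<alpha>[of a] \<alpha>[of b] assms B0
    by (intro sin_sum_le_sum_sin) (auto simp: split numeral_2_eq_2)
  then have "sin (\<alpha> a + \<alpha> b + sum \<alpha> B) \<le> sin (\<alpha> a + \<alpha> b) + sin (sum \<alpha> B)"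
    by (simp add: numeral_2_eq_2)
  moreover have "sin (sum \<alpha> B) \<le> (\<Sum>i\<in>B. sin (\<alpha> i))"
    using others(1) \<alpha> assms unfolding split
    by (intro sin_sum_le_sum_sin) (auto simp: B_def less_imp_le intro: order_trans[rotated] add_nonneg_nonneg)
  ultimately have "sin (sum \<alpha> (I - {m})) \<le> sin (\<alpha> a + \<alpha> b) + (\<Sum>i\<in>B. sin (\<alpha> i))"
    unfolding split by linarith
  then have "R * sin (sum \<alpha> (I - {m})) \<le> R * (sin (\<alpha> a + \<alpha> b) + (\<Sum>i\<in>B. sin (\<alpha> i)))"
    using \<open>0 < R\<close> by simp
  moreover have "sum s B = (\<Sum>i\<in>B. R * sin (\<alpha> i))"
    using \<alpha> by (intro sum.cong) (auto simp: B_def)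
  ultimately have 1: "R * (sin (\<alpha> a) + sin (\<alpha> b) - sin (\<alpha> a + \<alpha> b)) \<le> sum s (I - {m}) - s m"
    using others(2) \<alpha>[of a] \<alpha>[of b] assms unfolding split
    by (simp add: algebra_simps flip: sum_distrib_left)
  have pos: "0 < sin (\<alpha> a)" "0 < sin (\<alpha> b)"
    using \<alpha> assms by (auto intro: sin_gt_zero)
  have "(sin (\<alpha> b))\<^sup>2 = (1 - cos (\<alpha> b)) * (1 + cos (\<alpha> b))"
    by (simp add: sin_squared_eq algebra_simps power2_eq_square)
  also have "\<dots> \<le> (1 - cos (\<alpha> b)) * 2"
    by (intro mult_left_mono) auto
  finally have "sin (\<alpha> a) * (sin (\<alpha> b))\<^sup>2 \<le> sin (\<alpha> a) * ((1 - cos (\<alpha> b)) * 2)"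
    using pos by (intro mult_left_mono) auto
  \<comment> \<open>The bracket equals \<open>sin (\<alpha> a) * (1 - cos (\<alpha> b)) + sin
    (\<alpha> b) * (1 - cos (\<alpha> a))\<close>; the second term is dropped.\<close>
  also have "\<dots> \<le> 2 * (sin (\<alpha> a) + sin (\<alpha> b) - sin (\<alpha> a + \<alpha> b))"
    using pos mult_left_mono[OF cos_le_one[of "\<alpha> a"], of "sin (\<alpha> b)"]
    by (simp add: sin_add algebra_simps)
  finally have "R ^ 3 * (sin (\<alpha> a) * (sin (\<alpha> b))\<^sup>2)
      \<le> R ^ 3 * (2 * (sin (\<alpha> a) + sin (\<alpha> b) - sin (\<alpha> a + \<alpha> b)))"
    using \<open>0 < R\<close> by (intro mult_left_mono) auto
  also have "\<dots> = 2 * R\<^sup>2 * (R * (sin (\<alpha> a) + sin (\<alpha> b) - sin (\<alpha> a + \<alpha> b)))"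
    by (simp add: power2_eq_square power3_eq_cube)
  also have "\<dots> \<le> 2 * R\<^sup>2 * (sum s (I - {m}) - s m)"
    using 1 by (intro mult_left_mono) auto
  finally show ?thesis
    using \<alpha>[of a] \<alpha>[of b] assms by (simp add: power2_eq_square power3_eq_cube mult_ac)
qed

subsection \<open>Metric circles in the disc model\<close>

text \<open>The Moebius translation inside \<open>hcircle_point\<close>, named so that its isometry
  property can be proved once.\<close>

definition disc_translate :: "complex \<Rightarrow> complex \<Rightarrow> complex" where
  "disc_translate c w = (w + c) / (1 + cnj c * w)"

lemma disc_translate_denom_nonzero:
  assumes "c \<in> hplane" "w \<in> hplane"
  shows "1 + cnj c * w \<noteq> 0"
proof
  assume "1 + cnj c * w = 0"
  then have "cnj c * w = -1" by (simp add: add_eq_0_iff)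
  then have "cmod c * cmod w = 1"
    by (metis complex_mod_cnj norm_minus_cancel norm_mult norm_one)
  moreover have "cmod c * cmod w < 1 * 1"
    using assms by (intro mult_strict_mono') (auto simp: hplane_def)
  ultimately show False by simp
qed

lemma one_minus_cmod_sq_pos: "z \<in> hplane \<Longrightarrow> 0 < 1 - (cmod z)\<^sup>2"
  by (simp add: hplane_def abs_square_less_1)

text \<open>Expanding in coordinates gives the identity
  \<open>|1 + cnj c * w|^2 - |w + c|^2 = (1 - |c|^2) * (1 - |w|^2)\<close>.\<close>

lemma one_minus_cmod_sq_disc_translate:
  assumes "c \<in> hplane" "w \<in> hplane"
  shows "1 - (cmod (disc_translate c w))\<^sup>2
    = (1 - (cmod c)\<^sup>2) * (1 - (cmod w)\<^sup>2) / (cmod (1 + cnj c * w))\<^sup>2"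
proof -
  have "(cmod (1 + cnj c * w))\<^sup>2 - (cmod (w + c))\<^sup>2 = (1 - (cmod c)\<^sup>2) * (1 - (cmod w)\<^sup>2)"
    unfolding cmod_power2 by (simp add: power2_eq_square algebra_simps)
  then show ?thesis
    using disc_translate_denom_nonzero[OF assms]
    by (simp add: disc_translate_def norm_divide power_divide field_simps)
qed

lemma disc_translate_in_hplane:
  assumes "c \<in> hplane" "w \<in> hplane"
  shows "disc_translate c w \<in> hplane"
proof -
  have "0 < 1 - (cmod (disc_translate c w))\<^sup>2"
    unfolding one_minus_cmod_sq_disc_translate[OF assms]
    using assms disc_translate_denom_nonzero[OF assms]
    by (intro divide_pos_pos mult_pos_pos one_minus_cmod_sq_pos) auto
  then show ?thesis by (simp add: hplane_def abs_square_less_1)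
qed

lemma disc_translate_diff:
  assumes "c \<in> hplane" "w \<in> hplane" "v \<in> hplane"
  shows "disc_translate c w - disc_translate c v
    = (w - v) * of_real (1 - (cmod c)\<^sup>2) / ((1 + cnj c * w) * (1 + cnj c * v))"
  using disc_translate_denom_nonzero[OF assms(1,2)] disc_translate_denom_nonzero[OF assms(1,3)]
  unfolding disc_translate_def of_real_diff complex_norm_square
  by (simp add: field_simps)

lemma disc_translate_inverse:
  assumes "c \<in> hplane" "z \<in> hplane"
  shows "disc_translate c (disc_translate (- c) z) = z"
proof -
  have c': "- c \<in> hplane" using assms by (simp add: hplane_def)
  define u where "u = disc_translate (- c) z"
  have nz: "1 - cnj c * z \<noteq> 0" "1 + cnj c * u \<noteq> 0"
    using disc_translate_denom_nonzero[OF c' assms(2)]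
      disc_translate_denom_nonzero[OF assms(1) disc_translate_in_hplane[OF c' assms(2)]]
    by (auto simp: u_def)
  have "u * (1 - cnj c * z) = z - c"
    using nz by (simp add: u_def disc_translate_def)
  then have "u + c = z * (1 + cnj c * u)"
    by (simp add: algebra_simps)
  then show ?thesis
    using nz unfolding u_def[symmetric] by (simp add: disc_translate_def)
qed

section \<open>Hyperbolic distance and its invariance\<close>

lemma hdist_nonneg:
  assumes "z \<in> hplane" "w \<in> hplane"
  shows "0 \<le> hdist z w"
proof -
  have "1 \<le> 1 + 2 * (cmod (z - w))\<^sup>2 / ((1 - (cmod z)\<^sup>2) * (1 - (cmod w)\<^sup>2))"
    using assms[THEN one_minus_cmod_sq_pos] by simp
  then show ?thesis
    unfolding hdist_def by (rule arcosh_nonneg_real)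
qed

text \<open>\<open>cosh x = 1 + 2 * (sinh (x / 2))^2\<close> removes the arcosh and leaves the
  half-length sinh in which \<open>AC\<close> and \<open>HC\<close> are phrased.\<close>

lemma sinh_half_hdist_sq:
  assumes "z \<in> hplane" "w \<in> hplane"
  shows "(sinh (hdist z w / 2))\<^sup>2 = (cmod (z - w))\<^sup>2 / ((1 - (cmod z)\<^sup>2) * (1 - (cmod w)\<^sup>2))"
proof -
  have "1 + 2 * (sinh (hdist z w / 2))\<^sup>2 = cosh (hdist z w)"
    using cosh_double[of "hdist z w / 2"] by (simp add: cosh_square_eq)
  also have "\<dots> = 1 + 2 * (cmod (z - w))\<^sup>2 / ((1 - (cmod z)\<^sup>2) * (1 - (cmod w)\<^sup>2))"
    unfolding hdist_def using assms[THEN one_minus_cmod_sq_pos]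
    by (intro cosh_arcosh_real) simp
  finally show ?thesis by simp
qed

text \<open>In the quotient inside \<open>hdist\<close>, numerator and denominator both gain the
  factor \<open>(1 - |c|^2)^2 / (|1 + cnj c * w|^2 * |1 + cnj c * v|^2)\<close>, which
  cancels.\<close>

lemma hdist_disc_translate:
  assumes "c \<in> hplane" "w \<in> hplane" "v \<in> hplane"
  shows "hdist (disc_translate c w) (disc_translate c v) = hdist w v"
proof -
  have nz: "cmod (1 + cnj c * w) \<noteq> 0" "cmod (1 + cnj c * v) \<noteq> 0"
    using disc_translate_denom_nonzero assms by auto
  have pos: "0 < 1 - (cmod c)\<^sup>2" using one_minus_cmod_sq_pos assms by blast
  have mod: "cmod (disc_translate c w - disc_translate c v)
    = cmod (w - v) * (1 - (cmod c)\<^sup>2) / (cmod (1 + cnj c * w) * cmod (1 + cnj c * v))"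
    using pos unfolding disc_translate_diff[OF assms] norm_mult norm_divide norm_of_real by simp
  have "(cmod (disc_translate c w - disc_translate c v))\<^sup>2 /
      ((1 - (cmod (disc_translate c w))\<^sup>2) * (1 - (cmod (disc_translate c v))\<^sup>2))
    = (cmod (w - v))\<^sup>2 / ((1 - (cmod w)\<^sup>2) * (1 - (cmod v)\<^sup>2))"
    unfolding mod one_minus_cmod_sq_disc_translate[OF assms(1,2)]
      one_minus_cmod_sq_disc_translate[OF assms(1,3)]
    using nz pos by (simp add: power_divide power_mult_distrib power2_eq_square)
  then show ?thesis
    unfolding hdist_def times_divide_eq_right[symmetric] by (simp only:)
qed

section \<open>Parametrization of hyperbolic circles\<close>

lemma hcircle_point_eq:
  "hcircle_point c r t = disc_translate c (of_real (tanh (r / 2)) * cis t)"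
  by (simp add: hcircle_point_def disc_translate_def Let_def)

lemma tanh_cis_in_hplane: "of_real (tanh (r / 2)) * cis t \<in> hplane"
proof -
  have "\<bar>tanh (r / 2)\<bar> < 1"
    using tanh_real_lt_1[of "r / 2"] tanh_real_lt_1[of "- (r / 2)"] by (simp add: abs_if)
  then show ?thesis by (simp add: hplane_def norm_mult)
qed

lemma one_minus_tanh_sq: "1 - (tanh (x::real))\<^sup>2 = 1 / (cosh x)\<^sup>2"
proof -
  have "(cosh x)\<^sup>2 \<noteq> 0" by simp
  then show ?thesis
    by (simp add: tanh_def power_divide diff_divide_eq_iff sinh_square_eq del: power_eq_0_iff)
qed

text \<open>By isometry the centre may be moved to 0, where the Euclidean chord is
  \<open>2 * tanh (r / 2) * |sin ((a - b) / 2)|\<close>. Dividing by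
  \<open>1 - tanh^2 = 1 / cosh^2\<close> gives
  \<open>2 * sinh (r / 2) * cosh (r / 2) = sinh r\<close> as the factor.\<close>

lemma sinh_half_hdist_hcircle_point:
  assumes "c \<in> hplane" "0 < r"
  shows "sinh (hdist (hcircle_point c r a) (hcircle_point c r b) / 2) = sinh r * \<bar>sin ((a - b) / 2)\<bar>"
proof -
  define \<tau> where "\<tau> = tanh (r / 2)"
  let ?w = "\<lambda>t. of_real \<tau> * cis t"
  have w: "?w t \<in> hplane" for t unfolding \<tau>_def by (rule tanh_cis_in_hplane)
  have "?w a - ?w b = of_real \<tau> * (cis a - cis b)" by (simp add: algebra_simps)
  then have "(cmod (?w a - ?w b))\<^sup>2 = \<tau>\<^sup>2 * (cmod (cis a - cis b))\<^sup>2"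
    by (simp add: norm_mult power_mult_distrib)
  also have "(cmod (cis a - cis b))\<^sup>2
      = ((sin a)\<^sup>2 + (cos a)\<^sup>2) + ((sin b)\<^sup>2 + (cos b)\<^sup>2) - 2 * cos (a - b)"
    unfolding cmod_power2 cos_diff by (simp add: power2_eq_square algebra_simps)
  also have "\<dots> = 4 * (sin ((a - b) / 2))\<^sup>2"
  proof -
    have "2 - 2 * cos (2 * u) = 4 * (sin u)\<^sup>2" for u :: real
      unfolding cos_double_sin by simp
    from this[of "(a - b) / 2"] show ?thesis
      by (simp del: right_diff_distrib_numeral)
  qed
  finally have diff: "(cmod (?w a - ?w b))\<^sup>2 = \<tau>\<^sup>2 * (4 * (sin ((a - b) / 2))\<^sup>2)" .
  have one: "1 - (cmod (?w t))\<^sup>2 = 1 / (cosh (r / 2))\<^sup>2" for t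
    using one_minus_tanh_sq[of "r / 2"] by (simp add: norm_mult \<tau>_def)
  have "sinh r = 2 * sinh (r / 2) * cosh (r / 2)"
    using sinh_double[of "r / 2"] by simp
  then have "(sinh (hdist (?w a) (?w b) / 2))\<^sup>2 = (sinh r * \<bar>sin ((a - b) / 2)\<bar>)\<^sup>2"
    unfolding sinh_half_hdist_sq[OF w w] diff one
    by (simp add: \<tau>_def tanh_def power_divide power_mult_distrib power2_eq_square)
  then have "sinh (hdist (?w a) (?w b) / 2) = sinh r * \<bar>sin ((a - b) / 2)\<bar>"
    using hdist_nonneg[OF w w] assms by (simp add: power2_eq_iff_nonneg)
  then show ?thesis
    unfolding hcircle_point_eq \<tau>_def[symmetric] hdist_disc_translate[OF assms(1) w w] .
qed

lemma hcircle_point_0_in_hcircle: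
  assumes "0 < r"
  shows "hcircle_point 0 r t \<in> hcircle 0 r"
proof -
  let ?w = "of_real (tanh (r / 2)) * cis t"
  have w: "?w \<in> hplane" "0 \<in> hplane" by (rule tanh_cis_in_hplane) (simp add: hplane_def)
  have "(sinh (hdist 0 ?w / 2))\<^sup>2 = (sinh (r / 2))\<^sup>2"
    unfolding sinh_half_hdist_sq[OF w(2,1)]
    by (simp add: norm_mult one_minus_tanh_sq) (simp add: tanh_def power_divide)
  then have "hdist 0 ?w = r"
    using hdist_nonneg[OF w(2,1)] assms by (simp add: power2_eq_iff_nonneg)
  moreover have "hcircle_point 0 r t = ?w"
    by (simp add: hcircle_point_def Let_def)
  ultimately show ?thesis
    using w(1) by (simp only: hcircle_def mem_Collect_eq)
qed

text \<open>Translating \<open>c\<close> back to 0 sends \<open>z\<close> to some \<open>w\<close>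
  with \<open>|w|^2 / (1 - |w|^2) = (sinh (r / 2))^2\<close>, that is
  \<open>|w| = tanh (r / 2)\<close>; the parameter is the argument of \<open>w\<close>.\<close>

lemma hcircle_point_surj:
  assumes "c \<in> hplane" "0 < r" "z \<in> hcircle c r"
  obtains a where "z = hcircle_point c r a"
proof -
  have z: "z \<in> hplane" "hdist c z = r" using assms by (auto simp: hcircle_def)
  have c': "- c \<in> hplane" using assms by (simp add: hplane_def)
  define w where "w = disc_translate (- c) z"
  have one: "1 - (cmod w)\<^sup>2 = (1 - (cmod c)\<^sup>2) * (1 - (cmod z)\<^sup>2) / (cmod (1 - cnj c * z))\<^sup>2"
    using one_minus_cmod_sq_disc_translate[OF c' z(1)] by (simp add: w_def)
  have sq: "(cmod w)\<^sup>2 = (cmod (c - z))\<^sup>2 / (cmod (1 - cnj c * z))\<^sup>2"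
    by (simp add: w_def disc_translate_def norm_divide power_divide norm_minus_commute)
  have nz: "cmod (1 - cnj c * z) \<noteq> 0"
    using disc_translate_denom_nonzero[OF c' z(1)] by simp
  have "(sinh (r / 2))\<^sup>2 = (cmod w)\<^sup>2 / (1 - (cmod w)\<^sup>2)"
    using sinh_half_hdist_sq[OF assms(1) z(1)] nz unfolding z(2) one unfolding sq by simp
  moreover have "0 < 1 - (cmod w)\<^sup>2"
    unfolding w_def by (intro one_minus_cmod_sq_pos disc_translate_in_hplane c' z)
  moreover have "1 + (sinh (r / 2))\<^sup>2 \<noteq> 0"
    by (smt (verit) zero_le_power2)
  ultimately have "(cmod w)\<^sup>2 = (sinh (r / 2))\<^sup>2 / (1 + (sinh (r / 2))\<^sup>2)"
    by (simp add: nonzero_eq_divide_eq algebra_simps)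
  also have "\<dots> = (tanh (r / 2))\<^sup>2"
    by (simp add: tanh_def power_divide cosh_square_eq add.commute)
  finally have "cmod w = tanh (r / 2)"
    using assms(2) by (simp add: power2_eq_iff_nonneg)
  then have "w = of_real (tanh (r / 2)) * cis (Arg w)"
    using rcis_cmod_Arg[of w] by (simp add: rcis_def)
  then have "z = hcircle_point c r (Arg w)"
    unfolding hcircle_point_eq using disc_translate_inverse[OF assms(1) z(1)] by (simp add: w_def)
  then show thesis by (rule that)
qed

lemma hcircle_point_periodic: "hcircle_point c r (t + 2 * pi * of_int k) = hcircle_point c r t"
proof -
  have "cis (t + 2 * pi * of_int k) = cis t"
    by (simp flip: cis_mult)
  then show ?thesis by (simp only: hcircle_point_def)
qed

lemma hcircle_point_0_eq_iff:
  assumes "0 < r"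
  shows "hcircle_point 0 r a = hcircle_point 0 r b \<longleftrightarrow> (\<exists>k::int. a = b + 2 * pi * of_int k)"
proof -
  have "tanh (r / 2) \<noteq> 0" using assms by simp
  then have "hcircle_point 0 r a = hcircle_point 0 r b \<longleftrightarrow> cis a = cis b"
    by (simp add: hcircle_point_def Let_def del: tanh_real_zero_iff)
  also have "\<dots> \<longleftrightarrow> sin a = sin b \<and> cos a = cos b"
    by (auto simp: complex_eq_iff)
  also have "\<dots> \<longleftrightarrow> (\<exists>k::int. a = b + 2 * pi * of_int k)"
    by (rule sin_cos_eq_iff)
  finally show ?thesis .
qed

subsection \<open>The circumradius\<close>

text \<open>Measure the vertices by angles in [0, 2 pi) from \<open>x 0\<close>. The arc condition
  makes these angles increase, so half of their successive differences serve as
  \<open>\<alpha>\<close>, and the chord formula gives the side lengths.\<close>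

lemma cyclic_ngon_inscribed:
  assumes "2 \<le> n" "cyclic_ngon n d x c r"
  shows "\<exists>\<alpha>. inscribed {..<n} (\<lambda>i. sinh (d i / 2)) (sinh r) \<alpha>"
proof -
  note ngon = assms(2)[unfolded cyclic_ngon_def]
  have c: "c \<in> hplane" and r: "0 < r" using ngon by auto
  have x: "x i \<in> hcircle c r" if "i < n" for i using ngon that by auto
  obtain \<phi> where \<phi>: "x 0 = hcircle_point c r \<phi>"
    using hcircle_point_surj[OF c r x[of 0]] assms(1) by auto
  have "\<exists>s. 0 \<le> s \<and> s < 2 * pi \<and> x i = hcircle_point c r (\<phi> + s) \<and> (i = 0 \<longrightarrow> s = 0)"
    if i: "i < n" for i
  proof (cases "i = 0")
    case True
    then show ?thesis using \<phi> by auto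
  next
    case False
    obtain a where a: "x i = hcircle_point c r a"
      using hcircle_point_surj[OF c r x[OF i]] .
    \<comment> \<open>\<open>k\<close> counts the full turns to remove from
      \<open>a - \<phi>\<close>.\<close>
    define k where "k = \<lfloor>(a - \<phi>) / (2 * pi)\<rfloor>"
    define s where "s = a - \<phi> - 2 * pi * of_int k"
    have "of_int k \<le> (a - \<phi>) / (2 * pi)" "(a - \<phi>) / (2 * pi) < of_int k + 1"
      unfolding k_def by linarith+
    then have "0 \<le> s" "s < 2 * pi"
      by (simp_all add: s_def field_simps)
    moreover have "x i = hcircle_point c r (\<phi> + s)"
      using hcircle_point_periodic[of c r "\<phi> + s" k] by (simp add: a s_def)
    ultimately show ?thesis using False by blast
  qed
  then have "\<forall>i\<in>{..<n}. \<exists>s. 0 \<le> s \<and> s < 2 * pi \<and> x i = hcircle_point c r (\<phi> + s) \<and> (i = 0 \<longrightarrow> s = 0)"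
    by simp
  then obtain t where t:
    "\<And>i. i < n \<Longrightarrow> 0 \<le> t i \<and> t i < 2 * pi \<and> x i = hcircle_point c r (\<phi> + t i) \<and> (i = 0 \<longrightarrow> t i = 0)"
    unfolding bchoice_iff by auto
  have t0: "t 0 = 0" using t[of 0] assms(1) by simp
  have less: "t (i - 1) < t i" if "i \<in> {1..<n}" for i
  proof (rule ccontr)
    \<comment> \<open>otherwise the arc from \<open>x (i - 1)\<close> to \<open>x i\<close> would pass through \<open>x 0\<close>\<close>
    assume "\<not> t (i - 1) < t i"
    then have le: "t i \<le> t (i - 1)" by simp
    have i: "i < n" "i - 1 < n" "0 < n" using that by auto
    have "x 0 \<in> ccw_arc c r (x (i - 1)) (x i)"
      unfolding ccw_arc_def
    proof (intro CollectI exI conjI)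
      show "x 0 = hcircle_point c r (\<phi> + 2 * pi)"
        using \<phi> hcircle_point_periodic[of c r \<phi> 1] by simp
      show "x (i - 1) = hcircle_point c r (\<phi> + t (i - 1))" using t i by blast
      show "x i = hcircle_point c r (\<phi> + t i + 2 * pi)"
        using t[OF i(1)] hcircle_point_periodic[of c r "\<phi> + t i" 1] by simp
    qed (use le t[OF i(1)] t[OF i(2)] in auto)
    then show False using ngon that i by auto
  qed
  \<comment> \<open>Side \<open>i\<close> ends at vertex \<open>i\<close>, so side 0 is the closing
    side from \<open>x (n - 1)\<close> to \<open>x 0\<close>, over the central angle
    \<open>2 * pi - t (n - 1)\<close>.\<close>
  define \<alpha> where "\<alpha> i = (if i = 0 then pi - t (n - 1) / 2 else (t i - t (i - 1)) / 2)" for i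
  have chord: "sinh (hdist (x i) (x j) / 2) = sinh r * \<bar>sin ((t i - t j) / 2)\<bar>" if "i < n" "j < n" for i j
  proof -
    have "x i = hcircle_point c r (\<phi> + t i)" "x j = hcircle_point c r (\<phi> + t j)"
      using t that by blast+
    then show ?thesis
      using sinh_half_hdist_hcircle_point[OF c r, of "\<phi> + t i" "\<phi> + t j"] by simp
  qed
  have "inscribed {..<n} (\<lambda>i. sinh (d i / 2)) (sinh r) \<alpha>"
    unfolding inscribed_def
  proof (intro conjI[of "\<forall>i\<in>{..<n}. _ i"] ballI)
    have "sum \<alpha> {1..m} = t m / 2" for m
      by (induction m) (auto simp: \<alpha>_def t0 diff_divide_distrib)
    moreover have "{..<n} = insert 0 {1..n - 1}" using assms(1) by auto
    ultimately show "sum \<alpha> {..<n} = pi" by (simp add: \<alpha>_def)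
    fix i assume "i \<in> {..<n}"
    show "0 < \<alpha> i \<and> \<alpha> i < pi \<and> sinh (d i / 2) = sinh r * sin (\<alpha> i)"
    proof (cases "i = 0")
      case True
      have n1: "n - 1 \<in> {1..<n}" "n - 1 < n" "n - 1 - 1 < n" "0 < n" using assms(1) by auto
      have t1: "0 < t (n - 1)" "t (n - 1) < 2 * pi"
        using less[OF n1(1)] t[OF n1(2)] t[OF n1(3)] by auto
      then have "0 < sin (t (n - 1) / 2)" by (intro sin_gt_zero) auto
      then show ?thesis
        using t1 chord[OF n1(2,4)] ngon True by (simp add: \<alpha>_def t0)
    next
      case False
      then have i: "i \<in> {1..<n}" "i < n" "i - 1 < n" using \<open>i \<in> {..<n}\<close> by auto
      have \<alpha>: "0 < \<alpha> i" "\<alpha> i < pi"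
        using less[OF i(1)] t[OF i(2)] t[OF i(3)] False by (auto simp: \<alpha>_def)
      then have "0 < sin (\<alpha> i)" by (intro sin_gt_zero)
      moreover have "(t (i - 1) - t i) / 2 = - \<alpha> i" using False by (simp add: \<alpha>_def field_simps)
      ultimately have "sinh (hdist (x (i - 1)) (x i) / 2) = sinh r * sin (\<alpha> i)"
        unfolding chord[OF i(3,2)] by simp
      moreover have "hdist (x (i - 1)) (x i) = d i" using ngon i(1) by blast
      ultimately show ?thesis using \<alpha> by simp
    qed
  qed
  then show ?thesis by blast
qed

text \<open>Place the vertices on the circle about 0 at the partial sums of the central angles. The
  chord formula and injectivity of sinh give the side lengths; monotonicity of the partial sums
  gives the arc condition.\<close>

lemma inscribed_cyclic_ngon:
  assumes "2 \<le> n" "0 < r" "inscribed {..<n} (\<lambda>i. sinh (d i / 2)) (sinh r) \<alpha>"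
  shows "\<exists>x. cyclic_ngon n d x 0 r"
proof -
  have \<alpha>: "0 < \<alpha> i" "\<alpha> i < pi" "sinh (d i / 2) = sinh r * sin (\<alpha> i)" if "i < n" for i
    using assms(3) that by (auto simp: inscribed_def)
  have sum: "sum \<alpha> {..<n} = pi" using assms(3) by (simp add: inscribed_def)
  \<comment> \<open>The sum starts at 1 because \<open>\<alpha> 0\<close> belongs to the closing
    side; hence \<open>t 0 = 0\<close> and
    \<open>t (n - 1) = 2 * pi - 2 * \<alpha> 0\<close>.\<close>
  define t where "t i = 2 * sum \<alpha> {1..i}" for i
  define x where "x i = hcircle_point 0 r (t i)" for i
  have t_less: "t i < t j" if "i < j" "j < n" for i j
  proof -
    have "sum \<alpha> {1..i} < sum \<alpha> {1..j}"
      using that \<alpha> by (intro sum_strict_mono2[of _ _ j]) (auto simp: less_imp_le)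
    then show ?thesis by (simp add: t_def)
  qed
  have t0: "t 0 = 0" by (simp add: t_def)
  have t_nonneg: "0 \<le> t i" if "i < n" for i
    using t_less[of 0 i] t0 that by (cases "i = 0") auto
  have "{..<n} = insert 0 {1..n - 1}" using assms(1) by auto
  then have t_last: "t (n - 1) = 2 * pi - 2 * \<alpha> 0"
    using sum by (simp add: t_def)
  then have t_less_2pi: "t i < 2 * pi" if "i < n" for i
  proof -
    have "i = n - 1 \<or> i < n - 1 \<and> n - 1 < n" using that by linarith
    then have "t i \<le> t (n - 1)"
      using t_less[of i "n - 1"] by auto
    then show ?thesis using t_last \<alpha>(1)[of 0] assms(1) by simp
  qed
  have t_step: "t i - t (i - 1) = 2 * \<alpha> i" if "1 \<le> i" for i
    using that by (cases i) (auto simp: t_def)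
  have z: "0 \<in> hplane" by (simp add: hplane_def)
  have "cyclic_ngon n d x 0 r"
    unfolding cyclic_ngon_def
  proof (intro conjI ballI allI impI)
    show "x ` {..<n} \<subseteq> hcircle 0 r"
      using hcircle_point_0_in_hcircle[OF assms(2)] by (auto simp: x_def)
  next
    fix i assume i: "i \<in> {1..<n}"
    then have i': "i < n" "i - 1 < n" by auto
    have "sinh (hdist (x (i - 1)) (x i) / 2) = sinh r * \<bar>sin ((t (i - 1) - t i) / 2)\<bar>"
      unfolding x_def by (rule sinh_half_hdist_hcircle_point[OF z assms(2)])
    also have "(t (i - 1) - t i) / 2 = - \<alpha> i" using t_step[of i] i by simp
    also have "\<bar>sin (- \<alpha> i)\<bar> = sin (\<alpha> i)"
      using sin_gt_zero[OF \<alpha>(1,2)[OF i'(1)]] by simp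
    finally have "sinh (hdist (x (i - 1)) (x i) / 2) = sinh (d i / 2)"
      using \<alpha>(3)[OF i'(1)] by simp
    then show "hdist (x (i - 1)) (x i) = d i" by simp
    fix j assume j: "j < n" "j \<noteq> i"
    show "x j \<notin> ccw_arc 0 r (x (i - 1)) (x i)"
    proof
      assume "x j \<in> ccw_arc 0 r (x (i - 1)) (x i)"
      then obtain s a b where *: "x j = hcircle_point 0 r s" "x (i - 1) = hcircle_point 0 r a"
          "x i = hcircle_point 0 r b" and s: "a < b" "b \<le> a + 2 * pi" "a < s" "s \<le> b"
        by (auto simp: ccw_arc_def)
      obtain k l m :: int where k: "s = t j + 2 * pi * of_int k" and l: "a = t (i - 1) + 2 * pi * of_int l"
          and m: "b = t i + 2 * pi * of_int m"
        using *[symmetric] unfolding x_def hcircle_point_0_eq_iff[OF assms(2)] by blast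
      have less: "u < v" if "2 * pi * of_int u < 2 * pi * of_int v" for u v :: int
        using that by simp
      have bounds: "0 \<le> t (i - 1)" "t (i - 1) < t i" "t i < 2 * pi" "0 \<le> t j" "t j < 2 * pi"
        using t_nonneg t_less_2pi t_less[of "i - 1" i] i j i' by auto
      \<comment> \<open>All \<open>t\<close> values lie in [0, 2 pi), so
        \<open>a < b \<le> a + 2 * pi\<close> and \<open>a < s \<le> b\<close> force equal winding
        numbers. Thus \<open>t j\<close> lies in the interval from \<open>t (i - 1)\<close>,
        excluded, to \<open>t i\<close>, which leaves only \<open>j = i\<close>.\<close>
      have "l < m + 1" "m < l + 1"
        using bounds k l m s by (auto intro!: less simp: algebra_simps)
      then have "m = l" by simp
      have "l < k + 1" "k < m + 1"
        using bounds k l m s by (auto intro!: less simp: algebra_simps)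
      then have "k = l" using \<open>m = l\<close> by simp
      then have "t (i - 1) < t j" "t j \<le> t i"
        using s k l m \<open>m = l\<close> by auto
      then have "\<not> j < i - 1" "j \<noteq> i - 1" "\<not> i < j"
        using t_less[of j "i - 1"] t_less[of i j] i' j by auto
      then show False using j i by auto
    qed
  next
    have "sinh (hdist (x (n - 1)) (x 0) / 2) = sinh r * \<bar>sin ((t (n - 1) - t 0) / 2)\<bar>"
      unfolding x_def by (rule sinh_half_hdist_hcircle_point[OF z assms(2)])
    also have "(t (n - 1) - t 0) / 2 = pi - \<alpha> 0" using t_last t0 by simp
    also have "\<bar>sin (pi - \<alpha> 0)\<bar> = sin (\<alpha> 0)"
      using sin_gt_zero[OF \<alpha>(1,2)[of 0]] assms(1) by simp
    finally have "sinh (hdist (x (n - 1)) (x 0) / 2) = sinh (d 0 / 2)"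
      using \<alpha>(3)[of 0] assms(1) by simp
    then show "hdist (x (n - 1)) (x 0) = d 0" by simp
  qed (use z assms in auto)
  then show ?thesis by blast
qed

text \<open>This makes the description operator in \<open>J\<close> well defined:
  \<open>inscribed_exists\<close> supplies a polygon of radius \<open>arsinh R\<close>, and
  \<open>inscribed_radius_le\<close> used both ways shows that every cyclic polygon with these sides
  has this radius, whatever its centre and vertices.\<close>

lemma J_inscribed:
  assumes "3 \<le> n" "d \<in> AC n"
  shows "\<exists>\<alpha>. inscribed {..<n} (\<lambda>i. sinh (d i / 2)) (sinh (J n d)) \<alpha>"
proof -
  let ?s = "\<lambda>i. sinh (d i / 2)"
  have pos: "0 < ?s i" if "i \<in> {..<n}" for i
    using assms that by (auto simp: AC_def)
  have "\<exists>R \<alpha>. inscribed {..<n} ?s R \<alpha>"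
    using assms pos by (intro inscribed_exists) (auto simp: AC_def lessThan_empty_iff)
  then obtain R \<alpha> where R: "inscribed {..<n} ?s R \<alpha>" by blast
  have "0 < R"
    using inscribed_radius_ge[OF R, of 0] pos[of 0] assms(1) by simp
  define r where "r = arsinh R"
  have r: "sinh r = R" "0 < r" using \<open>0 < R\<close> by (simp_all add: r_def)
  then obtain x where "cyclic_ngon n d x 0 r"
    using inscribed_cyclic_ngon[of n r d \<alpha>] R assms(1) by auto
  moreover have "q = r" if ngon: "cyclic_ngon n d y c q" for y c q
  proof -
    obtain \<beta> where S: "inscribed {..<n} ?s (sinh q) \<beta>"
      using cyclic_ngon_inscribed[OF _ ngon] assms(1) by auto
    have "sinh q \<le> R" "R \<le> sinh q"
      using inscribed_radius_le[OF _ _ pos R S] inscribed_radius_le[OF _ _ pos S R] assms(1) by auto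
    then show ?thesis using r by (metis order_antisym sinh_real_eq_iff)
  qed
  ultimately have "J n d = r"
    unfolding J_def by (intro the_equality) blast+
  then show ?thesis using R r by blast
qed

section \<open>Divergence of the circumradius\<close>

lemma filterlim_sinh_at_topD:
  fixes f :: "'a \<Rightarrow> real"
  assumes "filterlim (\<lambda>k. sinh (f k)) at_top F"
  shows "filterlim f at_top F"
  unfolding filterlim_at_top_dense
proof
  fix z
  have "eventually (\<lambda>k. sinh z < sinh (f k)) F"
    using assms unfolding filterlim_at_top_dense by blast
  then show "eventually (\<lambda>k. z < f k) F" by simp
qed

theorem proposition3p6:
  fixes n :: nat and d :: "nat \<Rightarrow> nat \<Rightarrow> real" and D :: "nat \<Rightarrow> ereal"
  assumes "n \<ge> 3"
    and "\<And>k. d k \<in> AC n"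
    and "D \<in> ereal_tuple n ` HC n \<union> HI n"
    and "limitin (ext_tuples n) (\<lambda>k. ereal_tuple n (d k)) D sequentially"
  shows "filterlim (\<lambda>k. J n (d k)) at_top sequentially"
proof (rule filterlim_sinh_at_topD)
  let ?s = "\<lambda>k i. sinh (d k i / 2)"
  let ?R = "\<lambda>k. sinh (J n (d k))"
  have "\<forall>k. \<exists>\<alpha>. inscribed {..<n} (?s k) (?R k) \<alpha>"
    using J_inscribed[OF assms(1,2)] by blast
  then obtain \<alpha> where \<alpha>: "\<And>k. inscribed {..<n} (?s k) (?R k) (\<alpha> k)"
    unfolding choice_iff by blast
  have pos: "0 < ?s k i" if "i < n" for k i
    using assms(2)[of k] that by (auto simp: AC_def)
  have R_ge: "0 < ?R k" "?s k i \<le> ?R k" if "i < n" for k i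
    using inscribed_radius_ge[OF \<alpha> _ pos[OF that]] that by simp_all
  \<comment> \<open>Convergence in the product of subspaces is coordinatewise convergence in the
    extended reals.\<close>
  have lim: "((\<lambda>k. ereal (d k i)) \<longlongrightarrow> D i) sequentially" if "i < n" for i
    using assms(4) that
    by (auto simp: ext_tuples_def limitin_componentwise limitin_subtopology ereal_tuple_def)
  show "filterlim ?R at_top sequentially"
    using assms(3)
  proof
    assume "D \<in> HI n"
    \<comment> \<open>At an infinite coordinate \<open>?s k i\<close> tends to infinity and bounds
      \<open>?R k\<close> from below.\<close>
    then obtain i where i: "i < n" "D i = \<infinity>" by (auto simp: HI_def)
    then have "filterlim (\<lambda>k. d k i) at_top sequentially"
      using lim[OF i(1)] by (simp add: tendsto_PInfty_eq_at_top)
    then have "filterlim (\<lambda>k. d k i * (1 / 2)) at_top sequentially"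
      by (rule filterlim_at_top_mult_tendsto_pos[OF tendsto_const, rotated]) simp
    then have "filterlim (\<lambda>k. d k i / 2) at_top sequentially" by simp
    then have "filterlim (\<lambda>k. ?s k i) at_top sequentially"
      by (rule filterlim_compose[OF sinh_real_at_top])
    then show ?thesis
      by (rule filterlim_at_top_mono) (rule always_eventually, rule allI, rule R_ge(2)[OF i(1)])
  next
    assume "D \<in> ereal_tuple n ` HC n"
    then obtain e where e: "e \<in> HC n" "D = ereal_tuple n e" by auto
    then obtain m where m: "m < n" "sinh (e m / 2) = (\<Sum>i\<in>{..<n} - {m}. sinh (e i / 2))"
      by (auto simp: HC_def)
    have lim_s: "((\<lambda>k. ?s k i) \<longlongrightarrow> sinh (e i / 2)) sequentially" if "i < n" for i
      using lim[OF that] that e by (auto simp: ereal_tuple_def intro!: tendsto_intros)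
    \<comment> \<open>The defect in the polygon inequality at \<open>m\<close>: positive on
      \<open>AC\<close>, and tending to 0 by the equation that defines \<open>HC\<close>.\<close>
    define gap where "gap k = sum (?s k) ({..<n} - {m}) - ?s k m" for k
    have "(gap \<longlongrightarrow> (\<Sum>i\<in>{..<n} - {m}. sinh (e i / 2)) - sinh (e m / 2)) sequentially"
      unfolding gap_def using m by (intro tendsto_intros lim_s) auto
    then have gap_0: "(gap \<longlongrightarrow> 0) sequentially" using m by simp
    have gap_pos: "0 < gap k" for k
      using assms(2)[of k] m by (auto simp: gap_def AC_def)
    have "2 \<le> card ({..<n} - {m})" using assms(1) m by simp
    then obtain a b where ab: "a \<in> {..<n} - {m}" "b \<in> {..<n} - {m}" "a \<noteq> b"
      by (metis card_le_Suc0_iff_eq finite_Diff finite_lessThan not_less_eq_eq numeral_2_eq_2)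
    \<comment> \<open>The left side of \<open>inscribed_gap\<close> has a positive limit, so its
      quotient by the vanishing gap diverges and pushes \<open>2 * (?R k)^2\<close> to
      infinity.\<close>
    have "((\<lambda>k. ?s k a * (?s k b)\<^sup>2) \<longlongrightarrow> sinh (e a / 2) * (sinh (e b / 2))\<^sup>2) sequentially"
      using ab by (intro tendsto_intros lim_s) auto
    moreover have "0 < sinh (e a / 2) * (sinh (e b / 2))\<^sup>2"
    proof -
      have "0 < e a" "0 < e b" using e(1) ab by (auto simp: HC_def)
      then show ?thesis by simp
    qed
    moreover have "filterlim (\<lambda>k. inverse (gap k)) at_top sequentially"
      using gap_0 gap_pos by (intro filterlim_inverse_at_top) auto
    ultimately have "filterlim (\<lambda>k. ?s k a * (?s k b)\<^sup>2 * inverse (gap k)) at_top sequentially"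
      by (rule filterlim_tendsto_pos_mult_at_top)
    moreover have "\<forall>k. ?s k a * (?s k b)\<^sup>2 * inverse (gap k) \<le> 2 * (?R k)\<^sup>2"
    proof
      fix k
      have "?s k a * (?s k b)\<^sup>2 \<le> 2 * (?R k)\<^sup>2 * gap k"
        unfolding gap_def using ab m by (intro inscribed_gap[OF _ \<alpha> R_ge(1)[OF m(1)]]) auto
      then show "?s k a * (?s k b)\<^sup>2 * inverse (gap k) \<le> 2 * (?R k)\<^sup>2"
        using gap_pos[of k] by (simp add: pos_divide_le_eq flip: divide_inverse)
    qed
    ultimately have R2: "filterlim (\<lambda>k. 2 * (?R k)\<^sup>2) at_top sequentially"
      by (rule filterlim_at_top_mono[OF _ always_eventually])
    show ?thesis
      unfolding filterlim_at_top_dense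
    proof
      \<comment> \<open>Comparing squares is valid for every sign of \<open>z\<close> because
        \<open>?R k\<close> is positive.\<close>
      fix z :: real
      have "eventually (\<lambda>k. 2 * z\<^sup>2 < 2 * (?R k)\<^sup>2) sequentially"
        using R2 unfolding filterlim_at_top_dense by blast
      then show "eventually (\<lambda>k. z < ?R k) sequentially"
        by (rule eventually_mono) (rule power2_less_imp_less, simp, rule less_imp_le, rule R_ge(1)[OF m(1)])
    qed
  qed
qed

end
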